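(* Fix a positive integer $n > 2$. Let $G$ and $H$ be maximal class $2$-groups of order $2^n$. Then the centralizer lattices $\mathcal{C}(G)$ and $\mathcal{C}(H)$ are isomorphic.
   Context: A $2$-group of order $2^n$ is of maximal class if its nilpotency class is $n-1$. For a group $G$ and a subset $X \subseteq G$, $\mathbf{C}_G(X) = \{g \in G : xg = gx \text{ for all } x \in X\}$ is the centralizer of $X$ in $G$. The centralizer lattice $\mathcal{C}(G)$ of a group $G$ is the poset (under inclusion) of all subgroups of $G$ of the form $\mathbf{C}_G(X)$ for some $X \subseteq G$, together with the meet $\mathbf{C}_G(X) \wedge_{\mathbf{C}} \mathbf{C}_G(Y) = \mathbf{C}_G(\langle X, Y\rangle)$ (which equals $\mathbf{C}_G(X) \cap \mathbf{C}_G(Y)$), the join $\mathbf{C}_G(X) \vee_{\mathbf{C}} \mathbf{C}_G(Y) = \mathbf{C}_G\big(\mathbf{C}_G(\mathbf{C}_G(X)) \wedge_{\mathbf{C}} \mathbf{C}_G(\mathbf{C}_G(Y))\big)$ (the smallest centralizer in $G$ containing both $\mathbf{C}_G(X)$ and $\mathbf{C}_G(Y)$), and the involution $\mathbf{C}_G(\cdot)$. A centralizer lattice homomorphism $f: \mathcal{C}(G) \to \mathcal{C}(H)$ is a map preserving $\wedge_{\mathbf{C}}$ and $\vee_{\mathbf{C}}$ and respecting the centralizer involution, i.e. $f(\mathbf{C}_G(\mathbf{C}_G(X))) = \mathbf{C}_H(f(\mathbf{C}_G(X)))$ for all $X \leq G$. Two centralizer lattices are isomorphic if there is a bijective centralizer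 lattice homomorphism between them. *)

theory Defs
  imports "HOL-Algebra.Generated_Groups"
begin

text \<open>Indexing is shifted by one: \<^term>\<open>lower_central_series G k\<close> is the term usually
  written \<open>\<gamma>\<^sub>k\<^sub>+\<^sub>1(G)\<close>, so that the nilpotency class is the least \<open>k\<close> at which it is trivial.
  Commutators follow the convention of \<^const>\<open>derived\<close>.\<close>

primrec lower_central_series :: "('a, 'b) monoid_scheme \<Rightarrow> nat \<Rightarrow> 'a set" where
  "lower_central_series G 0 = carrier G"
| "lower_central_series G (Suc k) =
     generate G {x \<otimes>\<^bsub>G\<^esub> g \<otimes>\<^bsub>G\<^esub> inv\<^bsub>G\<^esub> x \<otimes>\<^bsub>G\<^esub> inv\<^bsub>G\<^esub> g | x g.
                   x \<in> lower_central_series G k \<and> g \<in> carrier G}"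

definition nilpotent_group :: "('a, 'b) monoid_scheme \<Rightarrow> bool" where
  "nilpotent_group G \<longleftrightarrow> group G \<and> (\<exists>c. lower_central_series G c = {\<one>\<^bsub>G\<^esub>})"

definition nilpotency_class :: "('a, 'b) monoid_scheme \<Rightarrow> nat" where
  "nilpotency_class G = (LEAST c. lower_central_series G c = {\<one>\<^bsub>G\<^esub>})"

text \<open>The class condition is written additively to avoid truncated subtraction.\<close>

definition maximal_class_2_group :: "('a, 'b) monoid_scheme \<Rightarrow> bool" where
  "maximal_class_2_group G \<longleftrightarrow>
     nilpotent_group G \<and> (\<exists>m. order G = 2 ^ m \<and> nilpotency_class G + 1 = m)"

definition centralizer :: "('a, 'b) monoid_scheme \<Rightarrow> 'a set \<Rightarrow> 'a set" where
  "centralizer G X = {g \<in> carrier G. \<forall>x\<in>X. x \<otimes>\<^bsub>G\<^esub> g = g \<otimes>\<^bsub>G\<^esub> x}"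

definition centralizers :: "('a, 'b) monoid_scheme \<Rightarrow> 'a set set" where
  "centralizers G = {centralizer G X | X. X \<subseteq> carrier G}"

text \<open>The operations are given as functions of the centralizers themselves rather than of
  sets \<open>X\<close>, \<open>Y\<close> defining them; \<open>cent_meet_centralizer\<close> below is the description
  through \<open>\<langle>X, Y\<rangle>\<close>.\<close>

definition cent_meet :: "('a, 'b) monoid_scheme \<Rightarrow> 'a set \<Rightarrow> 'a set \<Rightarrow> 'a set" where
  "cent_meet G A B = A \<inter> B"

definition cent_join :: "('a, 'b) monoid_scheme \<Rightarrow> 'a set \<Rightarrow> 'a set \<Rightarrow> 'a set" where
  "cent_join G A B = centralizer G (cent_meet G (centralizer G A) (centralizer G B))"

definition centralizer_lattice_hom ::
    "('a, 'b) monoid_scheme \<Rightarrow> ('c, 'd) monoid_scheme \<Rightarrow> ('a set \<Rightarrow> 'c set) \<Rightarrow> bool" where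
  "centralizer_lattice_hom G H f \<longleftrightarrow>
     f \<in> centralizers G \<rightarrow> centralizers H \<and>
     (\<forall>A\<in>centralizers G. \<forall>B\<in>centralizers G. f (cent_meet G A B) = cent_meet H (f A) (f B)) \<and>
     (\<forall>A\<in>centralizers G. \<forall>B\<in>centralizers G. f (cent_join G A B) = cent_join H (f A) (f B)) \<and>
     (\<forall>X. subgroup X G \<longrightarrow>
        f (centralizer G (centralizer G X)) = centralizer H (f (centralizer G X)))"

definition centralizer_lattices_isomorphic ::
    "('a, 'b) monoid_scheme \<Rightarrow> ('c, 'd) monoid_scheme \<Rightarrow> bool" where
  "centralizer_lattices_isomorphic G H \<longleftrightarrow>
     (\<exists>f. centralizer_lattice_hom G H f \<and> bij_betw f (centralizers G) (centralizers H))"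

context group
begin

lemma inv_comm_element:
  assumes "x \<in> carrier G" "a \<in> carrier G" "x \<otimes> a = a \<otimes> x"
  shows "x \<otimes> inv a = inv a \<otimes> x"
proof -
  have "a \<otimes> (x \<otimes> inv a) = (x \<otimes> a) \<otimes> inv a"
    using assms by (simp flip: m_assoc)
  also have "\<dots> = x"
    using assms(1,2) by (simp add: m_assoc)
  also have "\<dots> = a \<otimes> (inv a \<otimes> x)"
    using assms(1,2) by (simp flip: m_assoc)
  finally show ?thesis
    using assms(1,2) by simp
qed

lemma subgroup_centralizer:
  assumes "X \<subseteq> carrier G"
  shows "subgroup (centralizer G X) G"
proof (rule subgroupI)
  show "centralizer G X \<subseteq> carrier G" by (auto simp: centralizer_def)
  show "centralizer G X \<noteq> {}" using assms by (auto simp: centralizer_def intro!: exI[of _ \<one>])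
  fix a assume a: "a \<in> centralizer G X"
  show "inv a \<in> centralizer G X"
    using a assms by (auto simp: centralizer_def subset_iff intro: inv_comm_element)
  fix b assume b: "b \<in> centralizer G X"
  have "x \<otimes> (a \<otimes> b) = (a \<otimes> b) \<otimes> x" if "x \<in> X" for x
  proof -
    have x: "x \<in> carrier G" "a \<in> carrier G" "b \<in> carrier G" "x \<otimes> a = a \<otimes> x" "x \<otimes> b = b \<otimes> x"
      using a b assms that by (auto simp: centralizer_def)
    then have "x \<otimes> (a \<otimes> b) = (a \<otimes> x) \<otimes> b" by (simp flip: m_assoc)
    also have "\<dots> = (a \<otimes> b) \<otimes> x" using x by (simp add: m_assoc)
    finally show ?thesis .
  qed
  then show "a \<otimes> b \<in> centralizer G X"
    using a b by (auto simp: centralizer_def)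
qed

lemma centralizer_subset_iff:
  assumes "X \<subseteq> carrier G" "Y \<subseteq> carrier G"
  shows "X \<subseteq> centralizer G Y \<longleftrightarrow> Y \<subseteq> centralizer G X"
  using assms by (fastforce simp: centralizer_def)

lemma centralizer_generate:
  assumes "X \<subseteq> carrier G"
  shows "centralizer G (generate G X) = centralizer G X"
proof
  show "centralizer G (generate G X) \<subseteq> centralizer G X"
    by (auto simp: centralizer_def intro: generate.incl)
  have C: "centralizer G X \<subseteq> carrier G" by (auto simp: centralizer_def)
  then have "X \<subseteq> centralizer G (centralizer G X)"
    using centralizer_subset_iff[OF C assms] by blast
  then have "generate G X \<subseteq> centralizer G (centralizer G X)"
    using subgroup_centralizer[OF C] by (rule generate_subgroup_incl)
  then show "centralizer G X \<subseteq> centralizer G (generate G X)"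
    using centralizer_subset_iff[OF C generate_incl[OF assms]] by blast
qed

lemma cent_meet_centralizer:
  assumes "X \<subseteq> carrier G" "Y \<subseteq> carrier G"
  shows "cent_meet G (centralizer G X) (centralizer G Y) = centralizer G (generate G (X \<union> Y))"
proof -
  have "centralizer G (X \<union> Y) = centralizer G X \<inter> centralizer G Y"
    by (auto simp: centralizer_def)
  then show ?thesis
    using assms by (simp add: cent_meet_def centralizer_generate)
qed

lemma cent_join_least:
  assumes "A \<in> centralizers G" "B \<in> centralizers G"
  shows "cent_join G A B \<in> centralizers G" "A \<subseteq> cent_join G A B" "B \<subseteq> cent_join G A B"
    and "\<And>C. C \<in> centralizers G \<Longrightarrow> A \<subseteq> C \<Longrightarrow> B \<subseteq> C \<Longrightarrow> cent_join G A B \<subseteq> C"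
proof -
  have AB: "A \<subseteq> carrier G" "B \<subseteq> carrier G"
    using assms by (auto simp: centralizers_def centralizer_def)
  show "cent_join G A B \<in> centralizers G"
    by (auto simp: cent_join_def cent_meet_def centralizers_def centralizer_def)
  show "A \<subseteq> cent_join G A B" "B \<subseteq> cent_join G A B"
    using AB by (auto simp: cent_join_def cent_meet_def centralizer_def)
  fix C assume "C \<in> centralizers G" and sub: "A \<subseteq> C" "B \<subseteq> C"
  then obtain Z where Z: "Z \<subseteq> carrier G" "C = centralizer G Z"
    by (auto simp: centralizers_def)
  then have "Z \<subseteq> cent_meet G (centralizer G A) (centralizer G B)"
    using sub AB by (simp add: centralizer_subset_iff cent_meet_def)
  then show "cent_join G A B \<subseteq> C"
    unfolding Z cent_join_def by (auto simp: centralizer_def)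
qed

end

end

theory Submission
  imports Defs "HOL-Algebra.Multiplicative_Group" "HOL-Computational_Algebra.Primes"
begin

text \<open>In a 2-group \<open>G\<close> of maximal class and order \<open>2\<^sup>n\<close> all lower central factors except the first
  (of order 4) have order 2. Successive squares of an element \<open>a\<close> with \<open>a\<^sup>2 \<notin> \<gamma>\<^sub>3(G)\<close> then descend
  through the series one term at a time, so that \<open>a\<close> generates an abelian subgroup \<open>A\<close> of index 2,
  while the centre has order 2. Consequently the centralizer of a noncentral element is \<open>A\<close> or one
  of \<open>2\<^sup>n\<^sup>-\<^sup>2\<close> subgroups \<open>\<langle>x\<rangle>Z(G)\<close> of order 4 with \<open>x \<notin> A\<close>; these are self-centralizing and any two
  of them meet in the centre. The lattice therefore has \<open>2\<^sup>n\<^sup>-\<^sup>2 + 1\<close> atoms, each fixed by the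
  involution, between the centre and \<open>G\<close>, and any bijection between the atoms of two such lattices
  extends to an isomorphism.\<close>

declare lower_central_series.simps(2) [simp del]

section \<open>Commutators, Lagrange and subgroups of index 2\<close>

lemma (in group) commute_iff_commutator:
  assumes "x \<in> carrier G" "y \<in> carrier G"
  shows "x \<otimes> y \<otimes> inv x \<otimes> inv y = \<one> \<longleftrightarrow> x \<otimes> y = y \<otimes> x"
proof -
  have "x \<otimes> y \<otimes> inv x \<otimes> inv y = (x \<otimes> y) \<otimes> inv (y \<otimes> x)"
    using assms by (simp add: inv_mult_group m_assoc)
  also have "\<dots> = \<one> \<longleftrightarrow> x \<otimes> y = y \<otimes> x"
    using assms inv_solve_right'[of "\<one>" "x \<otimes> y" "y \<otimes> x"] by simp
  finally show ?thesis .
qed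

text \<open>Lagrange inside \<open>K\<close>: the index is neither 0 nor 1.\<close>

lemma (in group) card_proper_subgroup:
  assumes "subgroup H G" "subgroup K G" "H \<subset> K" "finite K"
  shows "2 * card H \<le> card K"
proof -
  interpret K: group "G\<lparr>carrier := K\<rparr>"
    using assms(2) by (rule subgroup_imp_group)
  have "subgroup H (G\<lparr>carrier := K\<rparr>)"
    using assms by (auto intro: subgroup_incl)
  then have eq: "card (rcosets\<^bsub>G\<lparr>carrier := K\<rparr>\<^esub> H) * card H = card K"
    using K.lagrange by (auto simp: order_def)
  have "card H < card K"
    using assms by (simp add: psubset_card_mono)
  with eq have "card (rcosets\<^bsub>G\<lparr>carrier := K\<rparr>\<^esub> H) \<noteq> 0"
    "card (rcosets\<^bsub>G\<lparr>carrier := K\<rparr>\<^esub> H) \<noteq> 1"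
    by (metis mult_0 not_less_zero, metis mult_1 less_irrefl)
  then have "2 \<le> card (rcosets\<^bsub>G\<lparr>carrier := K\<rparr>\<^esub> H)" by linarith
  then show ?thesis using eq by (metis mult_le_mono1)
qed

text \<open>\<open>K\<close> is the disjoint union of \<open>H\<close> and the coset
  \<open>H #> x\<close>. As \<open>inv y\<close> lies outside \<open>H\<close>, it equals
  \<open>h \<otimes> x\<close> for some \<open>h\<close> in \<open>H\<close>, whence
  \<open>x \<otimes> y = inv h\<close>.\<close>

lemma (in group) index_2_mult:
  assumes "subgroup H G" "subgroup K G" "H \<subseteq> K" "finite K" "card K = 2 * card H"
    and x: "x \<in> K - H" and y: "y \<in> K - H"
  shows "x \<otimes> y \<in> H"
proof -
  have carr: "H \<subseteq> carrier G" "K \<subseteq> carrier G" "x \<in> carrier G" "y \<in> carrier G"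
    using assms by (auto dest: subgroup.subset)
  have "H #> x \<subseteq> K"
    using assms by (auto simp: r_coset_def intro: subgroup.m_closed)
  moreover have "(H #> x) \<inter> H = {}"
  proof -
    have "x \<in> H" if "h \<in> H" "h \<otimes> x \<in> H" for h
    proof -
      have "inv h \<otimes> (h \<otimes> x) \<in> H" using that assms(1) by (simp add: subgroup.m_closed subgroup.m_inv_closed)
      moreover have "h \<in> carrier G" using that carr by auto
      ultimately show ?thesis using carr by (simp flip: m_assoc)
    qed
    then show ?thesis using x by (auto simp: r_coset_def)
  qed
  moreover have "card (H #> x) = card H"
    using card_rcosets_equal[OF rcosetsI] carr by simp
  ultimately have "H \<union> (H #> x) = K"
    using assms by (intro card_subset_eq) (auto simp: card_Un_disjoint finite_subset Int_commute)
  moreover have "inv y \<in> K - H"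
    using y assms(1,2) carr by (metis DiffD1 DiffD2 DiffI inv_inv subgroup.m_inv_closed)
  ultimately obtain h where h: "h \<in> H" "inv y = h \<otimes> x"
    by (auto simp: r_coset_def)
  have hc: "h \<in> carrier G" using h carr by auto
  have "x \<otimes> y = inv h"
  proof -
    have "h \<otimes> (x \<otimes> y) = \<one>"
      using h hc carr by (metis l_inv m_assoc)
    then show ?thesis
      using hc carr by (metis inv_equality inv_inv inv_closed m_closed)
  qed
  then show ?thesis using h assms(1) by (simp add: subgroup.m_inv_closed)
qed

section \<open>Quotients and centralizers modulo a normal subgroup\<close>

lemma (in group) normal_is_kernel:
  assumes "N \<lhd> G"
  obtains Q :: "'a set monoid" and \<phi>
  where "group_hom G Q \<phi>" "\<And>x. x \<in> carrier G \<Longrightarrow> \<phi> x = \<one>\<^bsub>Q\<^esub> \<longleftrightarrow> x \<in> N"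
proof
  interpret normal N G by (rule assms)
  show "group_hom G (G Mod N) (\<lambda>a. N #> a)"
    using factorgroup_is_group r_coset_hom_Mod
    by (simp add: group_hom_def group_hom_axioms_def is_group)
  show "N #> x = \<one>\<^bsub>G Mod N\<^esub> \<longleftrightarrow> x \<in> N" if "x \<in> carrier G" for x
    using that coset_join1[OF _ that is_subgroup] coset_join2[OF that is_subgroup]
    unfolding FactGroup_def by auto
qed

text \<open>For normal \<open>N\<close> and \<open>X\<close> inside \<open>G\<close> this is the
  preimage in \<open>G\<close> of the centralizer of the image of \<open>X\<close> in
  \<open>G/N\<close>; with \<open>X = carrier G\<close> it is the preimage of the centre. Staying
  inside \<open>G\<close> lets orders be compared with those of the lower central terms.\<close>

definition centralizer_mod :: "('a, 'b) monoid_scheme \<Rightarrow> 'a set \<Rightarrow> 'a set \<Rightarrow> 'a set" where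
  "centralizer_mod G N X =
     {g \<in> carrier G. \<forall>x\<in>X. g \<otimes>\<^bsub>G\<^esub> x \<otimes>\<^bsub>G\<^esub> inv\<^bsub>G\<^esub> g \<otimes>\<^bsub>G\<^esub> inv\<^bsub>G\<^esub> x \<in> N}"

lemma (in group_hom) hom_commute_iff:
  assumes "\<And>x. x \<in> carrier G \<Longrightarrow> h x = \<one>\<^bsub>H\<^esub> \<longleftrightarrow> x \<in> N" "x \<in> carrier G" "y \<in> carrier G"
  shows "x \<otimes> y \<otimes> inv x \<otimes> inv y \<in> N \<longleftrightarrow> h x \<otimes>\<^bsub>H\<^esub> h y = h y \<otimes>\<^bsub>H\<^esub> h x"
  using assms(2,3) by (simp flip: assms(1) H.commute_iff_commutator)

context group
begin

lemma commutator_mem_sym: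
  assumes "N \<lhd> G" "x \<in> carrier G" "y \<in> carrier G"
  shows "x \<otimes> y \<otimes> inv x \<otimes> inv y \<in> N \<longleftrightarrow> y \<otimes> x \<otimes> inv y \<otimes> inv x \<in> N"
proof -
  obtain Q :: "'a set monoid" and \<phi> where Q: "group_hom G Q \<phi>"
    "\<And>x. x \<in> carrier G \<Longrightarrow> \<phi> x = \<one>\<^bsub>Q\<^esub> \<longleftrightarrow> x \<in> N"
    using normal_is_kernel[OF assms(1)] by blast
  show ?thesis
    using assms(2,3) by (auto simp: group_hom.hom_commute_iff[OF Q])
qed

lemma subgroup_centralizer_mod:
  assumes "N \<lhd> G" "X \<subseteq> carrier G"
  shows "subgroup (centralizer_mod G N X) G"
proof -
  obtain Q :: "'a set monoid" and \<phi> where Q: "group_hom G Q \<phi>"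
    "\<And>x. x \<in> carrier G \<Longrightarrow> \<phi> x = \<one>\<^bsub>Q\<^esub> \<longleftrightarrow> x \<in> N"
    using normal_is_kernel[OF assms(1)] by blast
  interpret h: group_hom G Q \<phi> by (rule Q)
  have C: "centralizer_mod G N X = {g \<in> carrier G. \<phi> g \<in> centralizer Q (\<phi> ` X)}"
    using assms(2) by (auto simp: centralizer_mod_def centralizer_def subset_iff h.hom_commute_iff[OF Q(2)])
  have S: "subgroup (centralizer Q (\<phi> ` X)) Q"
    using assms(2) by (intro h.H.subgroup_centralizer) auto
  show ?thesis
    unfolding C using S
    by (intro subgroupI) (auto intro: subgroup.m_closed subgroup.m_inv_closed dest: subgroup.one_closed intro!: exI[of _ \<one>])
qed

lemma normal_subset_centralizer_mod:
  assumes "N \<lhd> G" "X \<subseteq> carrier G"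
  shows "N \<subseteq> centralizer_mod G N X"
proof -
  obtain Q :: "'a set monoid" and \<phi> where Q: "group_hom G Q \<phi>"
    "\<And>x. x \<in> carrier G \<Longrightarrow> \<phi> x = \<one>\<^bsub>Q\<^esub> \<longleftrightarrow> x \<in> N"
    using normal_is_kernel[OF assms(1)] by blast
  interpret h: group_hom G Q \<phi> by (rule Q)
  have N: "N \<subseteq> carrier G" using assms(1) by (simp add: normal_imp_subgroup subgroup.subset)
  then have "\<phi> t = \<one>\<^bsub>Q\<^esub>" if "t \<in> N" for t using that Q(2) by auto
  with N show ?thesis using assms(2)
    by (auto simp: centralizer_mod_def subset_iff h.hom_commute_iff[OF Q(2)])
qed

text \<open>The centre of a nonabelian group has index at least 4: modulo \<open>N\<close>, it is
  properly contained in the centralizer of a noncentral \<open>x\<close>, because \<open>x\<close>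
  belongs to the latter, and that centralizer is again proper.\<close>

lemma index_center_mod:
  assumes "N \<lhd> G" "finite (carrier G)" "centralizer_mod G N (carrier G) \<noteq> carrier G"
  shows "4 * card (centralizer_mod G N (carrier G)) \<le> order G"
proof -
  let ?Z = "centralizer_mod G N (carrier G)"
  obtain x where x: "x \<in> carrier G" "x \<notin> ?Z"
    using assms(3) by (auto simp: centralizer_mod_def)
  let ?C = "centralizer_mod G N {x}"
  have S: "subgroup ?Z G" "subgroup ?C G"
    using assms(1) x by (auto intro: subgroup_centralizer_mod)
  have "x \<in> ?C"
    using x subgroup.one_closed[OF normal_imp_subgroup[OF assms(1)]] commute_iff_commutator[of x x]
    by (auto simp: centralizer_mod_def)
  then have "?Z \<subset> ?C" using x by (auto simp: centralizer_mod_def)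
  moreover have "?C \<subset> carrier G"
    using x commutator_mem_sym[OF assms(1)] by (auto simp: centralizer_mod_def)
  ultimately have "2 * card ?Z \<le> card ?C" "2 * card ?C \<le> card (carrier G)"
    using S assms(2) by (auto intro!: card_proper_subgroup simp: subgroup_self intro: finite_subset)
  then show ?thesis by (simp add: order_def)
qed

section \<open>The lower central series of an arbitrary group\<close>

lemma lower_central_series_normal: "lower_central_series G k \<lhd> G"
proof (induction k)
  case 0
  show ?case by (auto intro!: normal_invI simp: subgroup_self)
next
  case (Suc k)
  let ?L = "lower_central_series G k"
  have sub: "?L \<subseteq> carrier G" using Suc normal_imp_subgroup subgroup.subset by blast
  show ?case unfolding lower_central_series.simps
  proof (rule normal_generateI)
    fix h g assume "h \<in> {x \<otimes> y \<otimes> inv x \<otimes> inv y | x y. x \<in> ?L \<and> y \<in> carrier G}" and g: "g \<in> carrier G"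
    then obtain x y where xy: "x \<in> ?L" "y \<in> carrier G" "h = x \<otimes> y \<otimes> inv x \<otimes> inv y" by auto
    have x: "x \<in> carrier G" using xy sub by auto
    \<comment> \<open>Conjugation by \<open>g\<close> is a homomorphism preserving
      \<open>?L\<close>, so it maps each generating commutator to another one.\<close>
    define c where "c z = g \<otimes> z \<otimes> inv g" for z
    have c: "c z \<in> carrier G" if "z \<in> carrier G" for z using that g by (simp add: c_def)
    have m: "c (z \<otimes> w) = c z \<otimes> c w" if "z \<in> carrier G" "w \<in> carrier G" for z w
      using that g by (simp add: c_def m_assoc inv_solve_left' flip: m_assoc) (simp add: m_assoc)
    have i: "c (inv z) = inv (c z)" if "z \<in> carrier G" for z
      using that g by (simp add: c_def inv_mult_group m_assoc)
    have "c h = c x \<otimes> c y \<otimes> inv (c x) \<otimes> inv (c y)"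
      using xy x c by (simp add: m i)
    moreover have "c x \<in> ?L" using normal_invE(2)[OF Suc g xy(1)] by (simp add: c_def)
    ultimately show "g \<otimes> h \<otimes> inv g \<in> {x \<otimes> y \<otimes> inv x \<otimes> inv y | x y. x \<in> ?L \<and> y \<in> carrier G}"
      using c xy(2) unfolding c_def by blast
  qed (use sub in auto)
qed

lemma lower_central_series_subgroup: "subgroup (lower_central_series G k) G"
  by (simp add: lower_central_series_normal normal_imp_subgroup)

lemma lower_central_series_carrier: "lower_central_series G k \<subseteq> carrier G"
  by (simp add: lower_central_series_subgroup subgroup.subset)

lemma commutator_lower_central_series:
  assumes "x \<in> lower_central_series G k" "g \<in> carrier G"
  shows "x \<otimes> g \<otimes> inv x \<otimes> inv g \<in> lower_central_series G (Suc k)"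
  unfolding lower_central_series.simps by (rule generate.incl) (use assms in blast)

text \<open>The next term is the smallest normal subgroup modulo which the current one is central.
  Most later arguments use this property instead of the generating commutators.\<close>

lemma lower_central_series_Suc_subset_iff:
  assumes "N \<lhd> G"
  shows "lower_central_series G (Suc k) \<subseteq> N \<longleftrightarrow>
    lower_central_series G k \<subseteq> centralizer_mod G N (carrier G)"
proof
  assume "lower_central_series G (Suc k) \<subseteq> N"
  then show "lower_central_series G k \<subseteq> centralizer_mod G N (carrier G)"
    using commutator_lower_central_series lower_central_series_carrier
    unfolding centralizer_mod_def by blast
next
  assume "lower_central_series G k \<subseteq> centralizer_mod G N (carrier G)"
  then show "lower_central_series G (Suc k) \<subseteq> N"
    unfolding lower_central_series.simps
    by (intro generate_subgroup_incl) (auto simp: centralizer_mod_def normal_imp_subgroup assms)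
qed

lemma lower_central_series_Suc_subset:
  "lower_central_series G (Suc k) \<subseteq> lower_central_series G k"
  by (simp only: lower_central_series_Suc_subset_iff lower_central_series_normal
      normal_subset_centralizer_mod order_refl)

text \<open>Each term determines the next, so one repetition stops the descent for good. This makes
  the series strictly decreasing until it reaches its final value.\<close>

lemma lower_central_series_stationary:
  assumes "lower_central_series G (Suc k) = lower_central_series G k" "k \<le> l"
  shows "lower_central_series G l = lower_central_series G k"
  using assms(2)
proof (induction l rule: dec_induct)
  case (step l)
  then have "lower_central_series G (Suc l) = lower_central_series G (Suc k)"
    by (simp add: lower_central_series.simps(2))
  then show ?case using assms(1) by simp
qed simp

text \<open>In general \<open>[x\<^sup>2, g] = [x, [x, g]] [x, g]\<^sup>2\<close>; here the first
  factor is trivial because \<open>x\<close> commutes with \<open>w = [x, g]\<close>.\<close>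

lemma commutator_square:
  assumes "x \<in> carrier G" "g \<in> carrier G" "w = x \<otimes> g \<otimes> inv x \<otimes> inv g" "w \<otimes> x = x \<otimes> w"
  shows "(x \<otimes> x) \<otimes> g \<otimes> inv (x \<otimes> x) \<otimes> inv g = w \<otimes> w"
proof -
  have w: "w \<in> carrier G" using assms by simp
  have 1: "x \<otimes> g \<otimes> inv x = w \<otimes> g" using assms(1,2) by (simp add: assms(3) m_assoc)
  have "(x \<otimes> x) \<otimes> g \<otimes> inv (x \<otimes> x) \<otimes> inv g = x \<otimes> (x \<otimes> g \<otimes> inv x) \<otimes> inv x \<otimes> inv g"
    using assms(1,2) by (simp add: m_assoc inv_mult_group)
  also have "\<dots> = (x \<otimes> w) \<otimes> g \<otimes> inv x \<otimes> inv g"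
    using assms(1,2) w by (simp add: 1 m_assoc)
  also have "\<dots> = w \<otimes> (x \<otimes> g \<otimes> inv x \<otimes> inv g)"
    using assms(1,2) w by (simp add: assms(4)[symmetric] m_assoc)
  finally show ?thesis using assms(3) by simp
qed

end

section \<open>Maximal class: orders of the lower central terms\<close>

locale maximal_class_group = group G for G :: "('a, 'b) monoid_scheme" (structure) +
  fixes n :: nat
  assumes n_gt: "n > 2"
    and order_eq: "order G = 2 ^ n"
    and lower_central_series_last: "lower_central_series G (n - 1) = {\<one>}"
    and lower_central_series_nontrivial: "\<And>k. k < n - 1 \<Longrightarrow> lower_central_series G k \<noteq> {\<one>}"
begin

abbreviation L :: "nat \<Rightarrow> 'a set" where
  "L \<equiv> lower_central_series G"

lemma one_less: "1 < n - 1"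
  using n_gt by linarith

lemma finite_carrier: "finite (carrier G)"
  using order_eq order_gt_0_iff_finite by simp

lemma finite_L: "finite (L k)"
  using finite_carrier lower_central_series_carrier finite_subset by blast

lemma L_Suc_psubset:
  assumes "k < n - 1"
  shows "L (Suc k) \<subset> L k"
  using assms lower_central_series_Suc_subset[of k] lower_central_series_stationary[of k "n - 1"]
    lower_central_series_last lower_central_series_nontrivial by (metis less_imp_le psubsetI)

lemma card_L_Suc_le:
  assumes "k < n - 1"
  shows "2 * card (L (Suc k)) \<le> card (L k)"
  using assms by (intro card_proper_subgroup lower_central_series_subgroup L_Suc_psubset finite_L)

text \<open>The quotient by \<open>L 2\<close> is nonabelian because \<open>L 2\<close> is properly
  contained in \<open>L 1\<close>. This yields the factor 4, rather than 2, at the top of the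
  series.\<close>

lemma center_mod_L2:
  shows "L 1 \<subseteq> centralizer_mod G (L 2) (carrier G)"
    and "centralizer_mod G (L 2) (carrier G) \<noteq> carrier G"
proof -
  show "L 1 \<subseteq> centralizer_mod G (L 2) (carrier G)"
    using lower_central_series_Suc_subset_iff[OF lower_central_series_normal, of 1 2]
    by (simp add: numeral_2_eq_2)
  have "\<not> L (Suc 0) \<subseteq> L 2"
    using L_Suc_psubset[OF one_less] by (simp add: numeral_2_eq_2)
  then show "centralizer_mod G (L 2) (carrier G) \<noteq> carrier G"
    using lower_central_series_Suc_subset_iff[OF lower_central_series_normal, of 0 2]
    by auto
qed

text \<open>The order of \<open>G\<close> leaves no slack. Descending from the top,
  \<open>L 1\<close> has index at least 4 and each further step at least halves the order; ascending
  from the trivial term \<open>L (n - 1)\<close>, each step at least doubles it. The two bounds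
  coincide.\<close>

lemma card_L_mult: "k + 2 \<le> n \<Longrightarrow> 2 ^ (k + 2) * card (L (Suc k)) = 2 ^ n"
proof (rule antisym)
  assume k: "k + 2 \<le> n"
  show "2 ^ (k + 2) * card (L (Suc k)) \<le> 2 ^ n"
    using k
  proof (induction k)
    case 0
    have "card (L 1) \<le> card (centralizer_mod G (L 2) (carrier G))"
      using center_mod_L2 finite_carrier by (intro card_mono) (auto simp: centralizer_mod_def)
    then have "4 * card (L 1) \<le> order G"
      using index_center_mod[OF lower_central_series_normal finite_carrier center_mod_L2(2)]
      by linarith
    then show ?case by (simp add: order_eq)
  next
    case (Suc k)
    then have "2 * card (L (Suc (Suc k))) \<le> card (L (Suc k))"
      by (intro card_L_Suc_le) linarith
    then have "2 ^ (k + 2) * (2 * card (L (Suc (Suc k)))) \<le> 2 ^ (k + 2) * card (L (Suc k))"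
      by (rule mult_le_mono2)
    also have "\<dots> \<le> 2 ^ n" using Suc by simp
    finally show ?case by simp
  qed
  have "k \<le> n - 2" using k by simp
  then show "2 ^ n \<le> 2 ^ (k + 2) * card (L (Suc k))"
  proof (induction k rule: inc_induct)
    case base
    have "Suc (n - 2) = n - 1" "n - 2 + 2 = n" using n_gt by auto
    then show ?case
      using lower_central_series_last by simp
  next
    case (step k)
    then have "2 * card (L (Suc (Suc k))) \<le> card (L (Suc k))"
      by (intro card_L_Suc_le) linarith
    then have "2 ^ (k + 2) * (2 * card (L (Suc (Suc k)))) \<le> 2 ^ (k + 2) * card (L (Suc k))"
      by (rule mult_le_mono2)
    moreover have "2 ^ n \<le> 2 ^ (k + 2) * (2 * card (L (Suc (Suc k))))"
      using step by simp
    ultimately show ?case by (rule order_trans[rotated])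
  qed
qed

lemma card_L_1: "4 * card (L 1) = order G"
  using card_L_mult[of 0] n_gt by (simp add: order_eq)

lemma card_L_Suc:
  assumes "k + 3 \<le> n"
  shows "card (L (Suc k)) = 2 * card (L (Suc (Suc k)))"
proof -
  have "2 ^ (k + 2) * card (L (Suc k)) = 2 ^ (k + 2) * (2 * card (L (Suc (Suc k))))"
    using card_L_mult[of k] card_L_mult[of "Suc k"] assms
    by (simp add: algebra_simps)
  then show ?thesis by simp
qed

text \<open>The left side contains \<open>L 1\<close>, which has index exactly 4, and itself has
  index at least 4.\<close>

lemma center_mod_L2_eq: "centralizer_mod G (L 2) (carrier G) = L 1"
proof -
  have fin: "finite (centralizer_mod G (L 2) (carrier G))"
    using finite_carrier by (simp add: centralizer_mod_def)
  have "card (centralizer_mod G (L 2) (carrier G)) \<le> card (L 1)"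
    using index_center_mod[OF lower_central_series_normal finite_carrier center_mod_L2(2)] card_L_1
    by linarith
  then show ?thesis using card_seteq[OF fin center_mod_L2(1)] by simp
qed

lemma L_mult_mem:
  assumes "k + 3 \<le> n" "x \<in> L (Suc k) - L (Suc (Suc k))" "y \<in> L (Suc k) - L (Suc (Suc k))"
  shows "x \<otimes> y \<in> L (Suc (Suc k))"
  using index_2_mult[OF lower_central_series_subgroup lower_central_series_subgroup
      lower_central_series_Suc_subset finite_L card_L_Suc[OF assms(1)]] assms(2,3) by blast

text \<open>\<open>L (Suc k)\<close> is central modulo \<open>L (Suc (Suc k))\<close>. For positive
  \<open>k\<close> it has index 2 in \<open>L k\<close>, so if \<open>b\<close> were central as
  well, all of \<open>L k\<close> would be, and the series would become stationary too early. For
  \<open>k = 0\<close> the index is 4, and the known centre modulo \<open>L 2\<close> is used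
  instead.\<close>

lemma ex_commutator_not_mem:
  assumes "k + 3 \<le> n" "b \<in> L k - L (Suc k)"
  shows "\<exists>g\<in>carrier G. b \<otimes> g \<otimes> inv b \<otimes> inv g \<notin> L (Suc (Suc k))"
proof (rule ccontr)
  assume neg: "\<not> ?thesis"
  let ?K = "centralizer_mod G (L (Suc (Suc k))) (carrier G)"
  have bc: "b \<in> carrier G" using assms lower_central_series_carrier by blast
  then have b: "b \<in> ?K" using neg by (auto simp: centralizer_mod_def)
  show False
  proof (cases k)
    case 0
    then show ?thesis using b center_mod_L2_eq assms(2)
      by (simp add: numeral_2_eq_2)
  next
    case (Suc l)
    have K: "subgroup ?K G"
      by (rule subgroup_centralizer_mod[OF lower_central_series_normal order_refl])
    have LK: "L (Suc k) \<subseteq> ?K"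
      using lower_central_series_Suc_subset_iff[OF lower_central_series_normal] by blast
    have "y \<in> ?K" if y: "y \<in> L k" for y
    proof (cases "y \<in> L (Suc k)")
      case False
      have yc: "y \<in> carrier G" using y lower_central_series_carrier by blast
      have "y \<otimes> b \<in> ?K"
        using L_mult_mem[of l y b] assms y False LK unfolding Suc by auto
      then have "y \<otimes> b \<otimes> inv b \<in> ?K"
        using subgroup.m_closed[OF K _ subgroup.m_inv_closed[OF K b]] by blast
      then show ?thesis using yc bc by (simp add: m_assoc)
    qed (use LK in blast)
    then have "L (Suc k) \<subseteq> L (Suc (Suc k))"
      by (subst lower_central_series_Suc_subset_iff[OF lower_central_series_normal]) blast
    moreover have "Suc k < n - 1" using assms(1) by linarith
    ultimately show False using L_Suc_psubset[of "Suc k"] by blast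
  qed
qed

section \<open>Squares along the series, a cyclic subgroup of index 2, and the centre\<close>

text \<open>If \<open>a\<close> is outside \<open>L 1\<close>, it is not central modulo
  \<open>L 2\<close>, so its centralizer modulo \<open>L 2\<close> lies strictly between
  \<open>L 1\<close> and \<open>G\<close>. It therefore contains \<open>L 1\<close> with index 2,
  and the square of \<open>a\<close> falls into \<open>L 1\<close>.\<close>

lemma square_mem_L1:
  assumes a: "a \<in> carrier G"
  shows "a \<otimes> a \<in> L 1"
proof (cases "a \<in> L 1")
  case True
  then show ?thesis by (intro subgroup.m_closed[OF lower_central_series_subgroup])
next
  case False
  let ?C = "centralizer_mod G (L 2) {a}"
  have C: "subgroup ?C G"
    using a by (intro subgroup_centralizer_mod lower_central_series_normal) auto
  have sub: "L 1 \<subseteq> ?C" unfolding center_mod_L2_eq[symmetric]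
    using a by (auto simp: centralizer_mod_def)
  have aC: "a \<in> ?C"
    using a subgroup.one_closed[OF lower_central_series_subgroup] commute_iff_commutator[of a a]
    by (auto simp: centralizer_mod_def)
  have "?C \<noteq> carrier G"
  proof
    assume "?C = carrier G"
    then have "a \<in> centralizer_mod G (L 2) (carrier G)"
      using a commutator_mem_sym[OF lower_central_series_normal] by (auto simp: centralizer_mod_def)
    then show False using False center_mod_L2_eq by simp
  qed
  then have "?C \<subset> carrier G" by (auto simp: centralizer_mod_def)
  then have "2 * card ?C \<le> order G"
    unfolding order_def by (intro card_proper_subgroup C subgroup_self finite_carrier)
  moreover have fin: "finite ?C" using finite_carrier by (simp add: centralizer_mod_def)
  moreover have "2 * card (L 1) \<le> card ?C"
    using sub aC False by (intro card_proper_subgroup C lower_central_series_subgroup fin) blast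
  ultimately have "card ?C = 2 * card (L 1)" using card_L_1 by linarith
  then show ?thesis
    using False aC sub by (intro index_2_mult[OF lower_central_series_subgroup C _ fin]) auto
qed

text \<open>Otherwise every element of the quotient by \<open>L 2\<close> is its own inverse, which
  makes that quotient abelian.\<close>

lemma ex_square_not_mem_L2: "\<exists>a\<in>carrier G. a \<otimes> a \<notin> L 2"
proof (rule ccontr)
  assume neg: "\<not> ?thesis"
  obtain Q :: "'a set monoid" and \<phi> where Q: "group_hom G Q \<phi>"
    "\<And>x. x \<in> carrier G \<Longrightarrow> \<phi> x = \<one>\<^bsub>Q\<^esub> \<longleftrightarrow> x \<in> L 2"
    using normal_is_kernel[OF lower_central_series_normal] by blast
  interpret h: group_hom G Q \<phi> by (rule Q)
  have sq: "\<phi> x \<otimes>\<^bsub>Q\<^esub> \<phi> x = \<one>\<^bsub>Q\<^esub>" if "x \<in> carrier G" for x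
    using neg that Q(2)[of "x \<otimes> x"] by simp
  have inv: "inv\<^bsub>Q\<^esub> (\<phi> x) = \<phi> x" if "x \<in> carrier G" for x
    using sq that by (intro h.H.inv_equality) auto
  have "\<phi> x \<otimes>\<^bsub>Q\<^esub> \<phi> y = \<phi> y \<otimes>\<^bsub>Q\<^esub> \<phi> x" if "x \<in> carrier G" "y \<in> carrier G" for x y
    using inv[of "x \<otimes> y"] that by (simp add: h.H.inv_mult_group inv)
  then have "centralizer_mod G (L 2) (carrier G) = carrier G"
    by (auto simp: centralizer_mod_def h.hom_commute_iff[OF Q(2)])
  then show False using center_mod_L2 by simp
qed

text \<open>Modulo \<open>L (k + 3)\<close> every \<open>w = [c, g]\<close> lies in \<open>\<langle>c\<^sup>2\<rangle>\<close> times a central subgroup of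
  exponent 2, so it commutes with \<open>c\<close> and \<open>[c\<^sup>2, g] = w\<^sup>2\<close>, which would vanish if \<open>c\<^sup>4\<close> did.\<close>

lemma fourth_power_not_mem:
  assumes k: "k + 4 \<le> n" and c: "c \<in> L k" and b: "c \<otimes> c \<in> L (k + 1) - L (k + 2)"
  shows "(c \<otimes> c) \<otimes> (c \<otimes> c) \<in> L (k + 2) - L (k + 3)"
proof -
  obtain Q :: "'a set monoid" and \<phi> where Q: "group_hom G Q \<phi>"
    "\<And>x. x \<in> carrier G \<Longrightarrow> \<phi> x = \<one>\<^bsub>Q\<^esub> \<longleftrightarrow> x \<in> L (k + 3)"
    using normal_is_kernel[OF lower_central_series_normal] by blast
  interpret h: group_hom G Q \<phi> by (rule Q)
  have cc: "c \<in> carrier G" using c lower_central_series_carrier by blast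
  have uc: "u \<in> carrier G" if "u \<in> L i" for u i using that lower_central_series_carrier by blast
  have ucomm: "\<phi> u \<otimes>\<^bsub>Q\<^esub> \<phi> g = \<phi> g \<otimes>\<^bsub>Q\<^esub> \<phi> u" if "u \<in> L (k + 2)" "g \<in> carrier G" for u g
  proof -
    have "u \<otimes> g \<otimes> inv u \<otimes> inv g \<in> L (k + 3)"
      using commutator_lower_central_series[OF that] by (simp add: numeral_3_eq_3)
    then show ?thesis
      by (subst (asm) h.hom_commute_iff[OF Q(2)]) (use uc[OF that(1)] that(2) in auto)
  qed
  have usq: "\<phi> u \<otimes>\<^bsub>Q\<^esub> \<phi> u = \<one>\<^bsub>Q\<^esub>" if "u \<in> L (k + 2)" for u
  proof -
    have "u \<otimes> u \<in> L (k + 3)"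
    proof (cases "u \<in> L (k + 3)")
      case True
      then show ?thesis by (intro subgroup.m_closed[OF lower_central_series_subgroup])
    next
      case False
      then show ?thesis
        using L_mult_mem[of "Suc k" u u] that k by (simp add: numeral_3_eq_3)
    qed
    then show ?thesis using Q(2)[of "u \<otimes> u"] uc[OF that] by simp
  qed
  \<comment> \<open>Since \<open>c \<otimes> c\<close> is outside \<open>L (k + 2)\<close>, it is
    not central modulo \<open>L (k + 3)\<close>. The contradiction will be that its commutator with
    this \<open>g\<close> vanishes there.\<close>
  obtain g where g: "g \<in> carrier G"
    "(c \<otimes> c) \<otimes> g \<otimes> inv (c \<otimes> c) \<otimes> inv g \<notin> L (k + 3)"
    using ex_commutator_not_mem[of "Suc k" "c \<otimes> c"] b k by (auto simp: numeral_3_eq_3)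
  have mem: "(c \<otimes> c) \<otimes> (c \<otimes> c) \<in> L (k + 2)"
    using L_mult_mem[of k "c \<otimes> c" "c \<otimes> c"] b k by simp
  moreover have "(c \<otimes> c) \<otimes> (c \<otimes> c) \<notin> L (k + 3)"
  proof
    assume "(c \<otimes> c) \<otimes> (c \<otimes> c) \<in> L (k + 3)"
    then have b2: "\<phi> (c \<otimes> c) \<otimes>\<^bsub>Q\<^esub> \<phi> (c \<otimes> c) = \<one>\<^bsub>Q\<^esub>"
      using Q(2)[of "(c \<otimes> c) \<otimes> (c \<otimes> c)"] cc by simp
    define w where "w = c \<otimes> g \<otimes> inv c \<otimes> inv g"
    have w: "w \<in> L (k + 1)" using commutator_lower_central_series[OF c g(1)] by (simp add: w_def)
    have "\<phi> w \<otimes>\<^bsub>Q\<^esub> \<phi> c = \<phi> c \<otimes>\<^bsub>Q\<^esub> \<phi> w \<and> \<phi> w \<otimes>\<^bsub>Q\<^esub> \<phi> w = \<one>\<^bsub>Q\<^esub>"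
    proof (cases "w \<in> L (k + 2)")
      case True
      then show ?thesis using ucomm usq cc by blast
    next
      case False
      \<comment> \<open>Both factors lie in \<open>L (k + 1)\<close> outside
        \<open>L (k + 2)\<close>, a subgroup of index 2, so \<open>u\<close> lies in
        \<open>L (k + 2)\<close> and is central modulo \<open>L (k + 3)\<close>. As
        \<open>?b\<close> is its own inverse, \<open>\<phi> w\<close> is the product of
        \<open>\<phi> u\<close> and \<open>?b\<close>.\<close>
      define u where "u = w \<otimes> (c \<otimes> c)"
      have u: "u \<in> L (k + 2)"
        using L_mult_mem[of k w "c \<otimes> c"] w False b k by (simp add: u_def)
      let ?b = "\<phi> (c \<otimes> c)"
      have bc: "?b \<in> carrier Q" "\<phi> u \<in> carrier Q" "\<phi> c \<in> carrier Q" "\<phi> w \<in> carrier Q"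
        using cc uc[OF u] uc[OF w] by auto
      have "\<phi> w \<otimes>\<^bsub>Q\<^esub> ?b \<otimes>\<^bsub>Q\<^esub> ?b = \<phi> w"
        using bc b2 by (simp add: h.H.m_assoc del: h.hom_mult)
      then have W: "\<phi> w = \<phi> u \<otimes>\<^bsub>Q\<^esub> ?b"
        using cc uc[OF w] by (simp add: u_def)
      have ub: "?b \<otimes>\<^bsub>Q\<^esub> \<phi> u = \<phi> u \<otimes>\<^bsub>Q\<^esub> ?b" using ucomm[OF u, of "c \<otimes> c"] cc by simp
      have cb: "\<phi> c \<otimes>\<^bsub>Q\<^esub> ?b = ?b \<otimes>\<^bsub>Q\<^esub> \<phi> c" using cc by (simp add: h.H.m_assoc)
      have "\<phi> w \<otimes>\<^bsub>Q\<^esub> \<phi> c = \<phi> u \<otimes>\<^bsub>Q\<^esub> \<phi> c \<otimes>\<^bsub>Q\<^esub> ?b"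
        using bc unfolding W by (simp add: h.H.m_assoc cb del: h.hom_mult)
      also have "\<dots> = \<phi> c \<otimes>\<^bsub>Q\<^esub> \<phi> w"
        using bc unfolding W ucomm[OF u cc] by (simp add: h.H.m_assoc del: h.hom_mult)
      finally have "\<phi> w \<otimes>\<^bsub>Q\<^esub> \<phi> c = \<phi> c \<otimes>\<^bsub>Q\<^esub> \<phi> w" .
      moreover have "\<phi> w \<otimes>\<^bsub>Q\<^esub> \<phi> w = \<phi> u \<otimes>\<^bsub>Q\<^esub> (?b \<otimes>\<^bsub>Q\<^esub> \<phi> u) \<otimes>\<^bsub>Q\<^esub> ?b"
        using bc unfolding W by (simp add: h.H.m_assoc del: h.hom_mult)
      then have "\<phi> w \<otimes>\<^bsub>Q\<^esub> \<phi> w = (\<phi> u \<otimes>\<^bsub>Q\<^esub> \<phi> u) \<otimes>\<^bsub>Q\<^esub> (?b \<otimes>\<^bsub>Q\<^esub> ?b)"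
        using bc unfolding ub by (simp add: h.H.m_assoc del: h.hom_mult)
      then have "\<phi> w \<otimes>\<^bsub>Q\<^esub> \<phi> w = \<one>\<^bsub>Q\<^esub>" using usq[OF u] b2 by simp
      ultimately show ?thesis by simp
    qed
    moreover have "\<phi> w = \<phi> c \<otimes>\<^bsub>Q\<^esub> \<phi> g \<otimes>\<^bsub>Q\<^esub> inv\<^bsub>Q\<^esub> \<phi> c \<otimes>\<^bsub>Q\<^esub> inv\<^bsub>Q\<^esub> \<phi> g"
      using cc g(1) by (simp add: w_def)
    ultimately have "\<phi> ((c \<otimes> c) \<otimes> g \<otimes> inv (c \<otimes> c) \<otimes> inv g) = \<one>\<^bsub>Q\<^esub>"
      using h.H.commutator_square[of "\<phi> c" "\<phi> g" "\<phi> w"] cc g(1) by simp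
    then show False using Q(2)[of "(c \<otimes> c) \<otimes> g \<otimes> inv (c \<otimes> c) \<otimes> inv g"] g cc by simp
  qed
  ultimately show ?thesis by simp
qed

text \<open>The induction carries the membership of one power together with the exact layer of its
  square, since \<open>fourth_power_not_mem\<close> needs both for \<open>c\<close> equal to that
  power.\<close>

lemma ex_pow_neq_one: "\<exists>a\<in>carrier G. a [^] (2 ^ (n - 2) :: nat) \<noteq> \<one>"
proof -
  obtain a where a: "a \<in> carrier G" "a \<otimes> a \<notin> L 2"
    using ex_square_not_mem_L2 by blast
  have dbl: "a [^] (2 ^ Suc j :: nat) = a [^] (2 ^ j :: nat) \<otimes> a [^] (2 ^ j :: nat)" for j
    using a(1) by (simp add: nat_pow_mult mult_2)
  have "a [^] (2 ^ k :: nat) \<in> L k \<and> a [^] (2 ^ Suc k :: nat) \<in> L (k + 1) - L (k + 2)"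
    if "k + 3 \<le> n" for k
    using that
  proof (induction k)
    case 0
    then show ?case using a square_mem_L1 dbl[of 0]
      by (simp add: numeral_2_eq_2)
  next
    case (Suc k)
    then have IH: "a [^] (2 ^ k :: nat) \<in> L k" "a [^] (2 ^ Suc k :: nat) \<in> L (k + 1) - L (k + 2)"
      by auto
    have "a [^] (2 ^ Suc (Suc k) :: nat) \<in> L (k + 2) - L (k + 3)"
      unfolding dbl[of "Suc k"] unfolding dbl[of k]
      using fourth_power_not_mem[of k "a [^] (2 ^ k :: nat)"] IH Suc.prems
      unfolding dbl[of k] by simp
    then show ?case using IH by (simp add: numeral_3_eq_3 power_Suc)
  qed
  \<comment> \<open>This is the largest admissible index, and the term avoided is the trivial one,
    \<open>L (n - 1)\<close>.\<close>
  from this[of "n - 3"] have "a [^] (2 ^ Suc (n - 3) :: nat) \<notin> L (n - 3 + 2)"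
    using n_gt by auto
  moreover have "n - 3 + 2 = n - 1" "Suc (n - 3) = n - 2" using n_gt by auto
  ultimately show ?thesis using a(1) lower_central_series_last by (metis singletonI)
qed

lemma centralizer_mod_one:
  "X \<subseteq> carrier G \<Longrightarrow> centralizer_mod G {\<one>} X = centralizer G X"
  by (auto simp: centralizer_mod_def centralizer_def commute_iff_commutator subset_iff)

lemma not_commutative: "centralizer G (carrier G) \<noteq> carrier G"
proof
  assume "centralizer G (carrier G) = carrier G"
  then have "L 1 \<subseteq> {\<one>}"
    using lower_central_series_Suc_subset_iff[OF one_is_normal, of 0]
    by (simp add: centralizer_mod_one)
  then show False
    using lower_central_series_nontrivial[OF one_less]
      subgroup.one_closed[OF lower_central_series_subgroup, of 1] by auto
qed

text \<open>The witness is cyclic. The order of \<open>a\<close> is a power of 2 not dividing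
  \<open>2 ^ (n - 2)\<close>, hence at least \<open>2 ^ (n - 1)\<close>; it cannot be larger because
  \<open>G\<close> is not abelian.\<close>

lemma ex_abelian_subgroup:
  "\<exists>A. subgroup A G \<and> order G = 2 * card A \<and> (\<forall>x\<in>A. \<forall>y\<in>A. x \<otimes> y = y \<otimes> x)"
proof -
  obtain a where a: "a \<in> carrier G" "a [^] (2 ^ (n - 2) :: nat) \<noteq> \<one>"
    using ex_pow_neq_one by blast
  let ?A = "generate G {a}"
  have A: "subgroup ?A G" using a by (intro generate_is_subgroup) auto
  have comm: "x \<otimes> y = y \<otimes> x" if "x \<in> ?A" "y \<in> ?A" for x y
    using that a by (auto simp: generate_pow add.commute simp flip: int_pow_mult)
  then have "?A \<noteq> carrier G"
    using not_commutative by (auto simp: centralizer_def)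
  then have "?A \<subset> carrier G" using subgroup.subset[OF A] by blast
  then have le: "2 * card ?A \<le> order G"
    unfolding order_def by (intro card_proper_subgroup A subgroup_self finite_carrier)
  have "ord a dvd 2 ^ n" using ord_dvd_group_order[OF a(1)] order_eq by simp
  then obtain j where j: "ord a = 2 ^ j" using divides_primepow_nat[OF two_is_prime_nat] by blast
  have "\<not> 2 ^ j dvd (2 ^ (n - 2) :: nat)" using a j pow_eq_id by auto
  then have "n - 1 \<le> j" using le_imp_power_dvd[of j "n - 2" "2 :: nat"] by linarith
  moreover have "card ?A = 2 ^ j" using generate_pow_card[OF a(1)] j by simp
  ultimately have "2 ^ (n - 1) \<le> card ?A" by simp
  moreover have "(2 :: nat) ^ n = 2 * 2 ^ (n - 1)" using n_gt by (simp flip: power_Suc)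
  ultimately have "order G = 2 * card ?A" using le order_eq by simp
  then show ?thesis using A comm by blast
qed

text \<open>A central element of \<open>L k\<close> outside \<open>L (Suc k)\<close> would have a
  nontrivial commutator by \<open>ex_commutator_not_mem\<close>, so the centre sinks down to
  \<open>L (n - 2)\<close>. That term has order 2 and is central because the next one is
  trivial.\<close>

lemma card_center: "card (centralizer G (carrier G)) = 2"
proof -
  let ?Z = "centralizer G (carrier G)"
  have Zk: "?Z \<subseteq> L k" if "k + 2 \<le> n" for k
    using that
  proof (induction k)
    case 0
    show ?case by (auto simp: centralizer_def)
  next
    case (Suc k)
    have "z \<in> L (Suc k)" if z: "z \<in> ?Z" for z
    proof (rule ccontr)
      assume "z \<notin> L (Suc k)"
      then obtain g where "g \<in> carrier G" "z \<otimes> g \<otimes> inv z \<otimes> inv g \<notin> L (Suc (Suc k))"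
        using ex_commutator_not_mem[of k z] Suc z by auto
      then show False
        using z commute_iff_commutator[of z g] subgroup.one_closed[OF lower_central_series_subgroup]
        by (auto simp: centralizer_def)
    qed
    then show ?case by blast
  qed
  have "L (n - 2) \<subseteq> ?Z"
    using lower_central_series_Suc_subset_iff[OF one_is_normal, of "n - 2"] lower_central_series_last n_gt
    by (simp add: centralizer_mod_one Suc_diff_le numeral_2_eq_2 Suc_diff_Suc)
  then have "?Z = L (n - 2)" using Zk[of "n - 2"] n_gt by simp
  moreover have "card (L (n - 2)) = 2"
    using card_L_mult[of "n - 3"] card_L_Suc[of "n - 3"] n_gt lower_central_series_last
    by (simp add: numeral_2_eq_2 numeral_3_eq_3 Suc_diff_Suc)
  ultimately show ?thesis by simp
qed

end

text \<open>Nilpotency ensures that the \<open>LEAST\<close> in the nilpotency class is attained;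
  its minimality gives nontriviality of the earlier terms.\<close>

lemma maximal_class_groupI:
  assumes "n > 2" "maximal_class_2_group G" "order G = 2 ^ n"
  shows "maximal_class_group G n"
proof -
  from assms(2,3) have nil: "nilpotent_group G" and cl: "nilpotency_class G + 1 = n"
    by (auto simp: maximal_class_2_group_def)
  then interpret group G by (simp add: nilpotent_group_def)
  obtain c where c: "lower_central_series G c = {\<one>\<^bsub>G\<^esub>}"
    using nil by (auto simp: nilpotent_group_def)
  have "nilpotency_class G = n - 1" using cl by simp
  then show ?thesis
    using assms c LeastI[of "\<lambda>c. lower_central_series G c = {\<one>\<^bsub>G\<^esub>}" c]
      not_less_Least[of _ "\<lambda>c. lower_central_series G c = {\<one>\<^bsub>G\<^esub>}"]
    by unfold_locales (auto simp: nilpotency_class_def)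
qed

section \<open>Isomorphisms between centralizer lattices\<close>

lemma centralizer_subset_carrier: "centralizer G X \<subseteq> carrier G"
  by (auto simp: centralizer_def)

lemma centralizer_in_centralizers: "X \<subseteq> carrier G \<Longrightarrow> centralizer G X \<in> centralizers G"
  by (auto simp: centralizers_def)

lemma centralizers_subset_carrier: "A \<in> centralizers G \<Longrightarrow> A \<subseteq> carrier G"
  by (auto simp: centralizers_def centralizer_def)

lemma centralizers_Int:
  assumes "A \<in> centralizers G" "B \<in> centralizers G"
  shows "A \<inter> B \<in> centralizers G"
proof -
  obtain X Y where "X \<subseteq> carrier G" "A = centralizer G X" "Y \<subseteq> carrier G" "B = centralizer G Y"
    using assms by (auto simp: centralizers_def)
  then have "A \<inter> B = centralizer G (X \<union> Y)" "X \<union> Y \<subseteq> carrier G"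
    by (auto simp: centralizer_def)
  then show ?thesis by (simp add: centralizer_in_centralizers)
qed

text \<open>The join is built from meet and involution, so preserving these two suffices.\<close>

lemma centralizer_lattices_isomorphicI:
  assumes "bij_betw f (centralizers G) (centralizers H)"
    and meet: "\<And>A B. A \<in> centralizers G \<Longrightarrow> B \<in> centralizers G \<Longrightarrow> f (A \<inter> B) = f A \<inter> f B"
    and inv: "\<And>A. A \<in> centralizers G \<Longrightarrow> f (centralizer G A) = centralizer H (f A)"
  shows "centralizer_lattices_isomorphic G H"
proof -
  have C: "centralizer G A \<in> centralizers G" if "A \<in> centralizers G" for A
    using that by (simp add: centralizer_in_centralizers centralizers_subset_carrier)
  have "f (cent_join G A B) = cent_join H (f A) (f B)"
    if "A \<in> centralizers G" "B \<in> centralizers G" for A B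
    using that by (simp add: cent_join_def cent_meet_def C centralizers_Int inv meet)
  moreover have "f (centralizer G (centralizer G X)) = centralizer H (f (centralizer G X))"
    if "subgroup X G" for X
    using that by (simp add: inv centralizer_in_centralizers subgroup.subset)
  ultimately show ?thesis
    using assms(1) meet unfolding centralizer_lattices_isomorphic_def centralizer_lattice_hom_def
    by (intro exI[of _ f]) (auto simp: cent_meet_def bij_betw_def)
qed

text \<open>The lattice has height 2, its atoms \<open>M\<close> being fixed by the centralizer involution.\<close>

definition fan_of_centralizers :: "('a, 'b) monoid_scheme \<Rightarrow> 'a set set \<Rightarrow> bool" where
  "fan_of_centralizers G M \<longleftrightarrow>
     centralizers G = insert (carrier G) (insert (centralizer G (carrier G)) M) \<and>
     carrier G \<notin> M \<and> centralizer G (carrier G) \<notin> M \<and>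
     centralizer G (carrier G) \<noteq> carrier G \<and>
     (\<forall>A\<in>M. centralizer G A = A) \<and>
     (\<forall>A\<in>M. \<forall>B\<in>M. A \<noteq> B \<longrightarrow> A \<inter> B = centralizer G (carrier G))"

lemma centralizer_center:
  "centralizer G (centralizer G (carrier G)) = carrier G"
  by (auto simp: centralizer_def)

lemma center_subset_centralizer:
  "X \<subseteq> carrier G \<Longrightarrow> centralizer G (carrier G) \<subseteq> centralizer G X"
  by (auto simp: centralizer_def)

text \<open>The operations see only the shape of the fan: the involution swaps top and bottom and
  fixes the atoms, and distinct atoms meet in the bottom. Hence the choice of bijection between the
  atoms is free.\<close>

lemma fan_of_centralizers_isomorphic:
  assumes G: "fan_of_centralizers G M" and H: "fan_of_centralizers H N"
    and fin: "finite M" "finite N" and card: "card M = card N"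
  shows "centralizer_lattices_isomorphic G H"
proof -
  let ?Z = "centralizer G (carrier G)" and ?W = "centralizer H (carrier H)"
  obtain g where g: "bij_betw g M N"
    using finite_same_card_bij[OF fin card] by blast
  \<comment> \<open>Top, bottom and atoms are mutually distinct in a fan, so the three cases do not
    interfere.\<close>
  define f where "f = (\<lambda>X. if X = carrier G then carrier H else if X = ?Z then ?W else g X)"
  have f: "f (carrier G) = carrier H" "f ?Z = ?W"
    using G by (auto simp: f_def fan_of_centralizers_def)
  have fM: "f A = g A" "g A \<in> N" if "A \<in> M" for A
    using G g that by (auto simp: f_def fan_of_centralizers_def bij_betw_def)
  have cG: "centralizers G = insert (carrier G) (insert ?Z M)"
    and cH: "centralizers H = insert (carrier H) (insert ?W N)"
    using G H by (simp_all add: fan_of_centralizers_def)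
  have subG: "?Z \<subseteq> A" "A \<subseteq> carrier G" if "A \<in> centralizers G" for A
    using that by (auto simp: centralizers_def centralizer_def)
  have subH: "?W \<subseteq> A" "A \<subseteq> carrier H" if "A \<in> centralizers H" for A
    using that by (auto simp: centralizers_def centralizer_def)
  have fin_cent: "f A \<in> centralizers H" if "A \<in> centralizers G" for A
    using that f fM unfolding cG cH by auto
  have "f ` centralizers G = centralizers H"
  proof -
    have "f ` M = N" using fM(1) g by (simp add: bij_betw_def)
    then show ?thesis unfolding cG cH by (simp add: f)
  qed
  moreover have "inj_on f (centralizers G)"
  proof -
    have inj: "inj_on f M" using g fM(1) by (simp add: bij_betw_def inj_on_def)
    have "f ` M \<subseteq> N" using fM by auto
    moreover have "carrier H \<notin> N" "?W \<notin> N" "?W \<noteq> carrier H"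
      using H by (simp_all add: fan_of_centralizers_def)
    ultimately have "f (carrier G) \<notin> f ` insert ?Z M" "f ?Z \<notin> f ` M"
      unfolding image_insert f by blast+
    then show ?thesis
      unfolding cG inj_on_insert using inj by blast
  qed
  moreover have "f (A \<inter> B) = f A \<inter> f B" if AB: "A \<in> centralizers G" "B \<in> centralizers G" for A B
  proof -
    consider "A = carrier G" | "B = carrier G" | "A = ?Z" | "B = ?Z" | "A = B"
      | "A \<in> M" "B \<in> M" "A \<noteq> B"
      using AB unfolding cG by blast
    then show ?thesis
    proof cases
      case 1
      then show ?thesis using subG[OF AB(2)] subH[OF fin_cent[OF AB(2)]] f
        by (simp add: Int_absorb1)
    next
      case 2
      then show ?thesis using subG[OF AB(1)] subH[OF fin_cent[OF AB(1)]] f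
        by (simp add: Int_absorb2)
    next
      case 3
      then show ?thesis using subG[OF AB(2)] subH[OF fin_cent[OF AB(2)]] f
        by (simp add: Int_absorb2)
    next
      case 4
      then show ?thesis using subG[OF AB(1)] subH[OF fin_cent[OF AB(1)]] f
        by (simp add: Int_absorb1)
    next
      case 5
      then show ?thesis by simp
    next
      case 6
      have "g A \<noteq> g B" using 6 g by (auto simp: bij_betw_def inj_on_def)
      then have "g A \<inter> g B = ?W" using H fM(2) 6 by (simp add: fan_of_centralizers_def)
      moreover have "A \<inter> B = ?Z" using G 6 by (simp add: fan_of_centralizers_def)
      ultimately show ?thesis using 6 f fM(1) by simp
    qed
  qed
  moreover have "f (centralizer G A) = centralizer H (f A)" if "A \<in> centralizers G" for A
  proof -
    have "centralizer G A = A" "centralizer H (g A) = g A" if "A \<in> M"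
      using G H fM(2)[OF that] that by (auto simp: fan_of_centralizers_def)
    then show ?thesis
      using that f fM(1) unfolding cG by (auto simp: centralizer_center)
  qed
  ultimately show ?thesis
    by (intro centralizer_lattices_isomorphicI[of f]) (auto simp: bij_betw_def)
qed

section \<open>Centralizers in a nonabelian group with an abelian subgroup of index 2\<close>

locale abelian_index_2 = group G for G :: "('a, 'b) monoid_scheme" (structure) +
  fixes A
  assumes subgroup_A: "subgroup A G"
    and finite_carrier: "finite (carrier G)"
    and order_eq: "order G = 2 * card A"
    and comm_A: "\<And>x y. x \<in> A \<Longrightarrow> y \<in> A \<Longrightarrow> x \<otimes> y = y \<otimes> x"
    and nonabelian: "centralizer G (carrier G) \<noteq> carrier G"
begin

abbreviation Z where "Z \<equiv> centralizer G (carrier G)"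
abbreviation C where "C x \<equiv> centralizer G {x}"

lemma A_carrier: "A \<subseteq> carrier G"
  by (simp add: subgroup.subset subgroup_A)

lemma mult_mem_A:
  assumes "x \<in> carrier G - A" "y \<in> carrier G - A"
  shows "x \<otimes> y \<in> A"
  using index_2_mult[OF subgroup_A subgroup_self A_carrier finite_carrier] order_eq assms
  by (simp add: order_def)

lemma subgroup_C: "x \<in> carrier G \<Longrightarrow> subgroup (C x) G"
  by (simp add: subgroup_centralizer)

lemma mem_C_sym: "x \<in> carrier G \<Longrightarrow> y \<in> C x \<Longrightarrow> x \<in> C y"
  by (simp add: centralizer_def)

lemma mem_C_self: "x \<in> carrier G \<Longrightarrow> x \<in> C x"
  by (simp add: centralizer_def)

lemma mem_center_iff: "t \<in> Z \<longleftrightarrow> t \<in> carrier G \<and> C t = carrier G"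
proof -
  have "C t = carrier G \<longleftrightarrow> carrier G \<subseteq> C t"
    using centralizer_subset_carrier[of G "{t}"] by blast
  then show ?thesis by (auto simp: centralizer_def subset_iff)
qed

text \<open>If \<open>g\<close> is outside \<open>A\<close>, then \<open>g \<otimes> x\<close> lies
  in \<open>A\<close>, hence in \<open>C t\<close>; cancelling \<open>x\<close> puts
  \<open>g\<close> there too. So \<open>C t\<close> is everything.\<close>

lemma mem_centerI:
  assumes t: "t \<in> carrier G" "A \<subseteq> C t" and x: "x \<in> C t" "x \<notin> A"
  shows "t \<in> Z"
proof -
  have S: "subgroup (C t) G" using t by (simp add: subgroup_C)
  have xc: "x \<in> carrier G" using x centralizer_subset_carrier[of G] by blast
  have "g \<in> C t" if g: "g \<in> carrier G" for g
  proof (cases "g \<in> A")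
    case False
    then have "g \<otimes> x \<in> C t" using mult_mem_A[of g x] g xc x t by auto
    then have "g \<otimes> x \<otimes> inv x \<in> C t"
      using subgroup.m_closed[OF S _ subgroup.m_inv_closed[OF S x(1)]] by blast
    then show ?thesis using g xc by (simp add: m_assoc)
  qed (use t in auto)
  then show ?thesis using t centralizer_subset_carrier[of G "{t}"] by (auto simp: mem_center_iff)
qed

lemma ex_not_mem_A: "\<exists>x\<in>carrier G. x \<notin> A"
proof -
  have "card A > 0"
    using finite_subset[OF A_carrier finite_carrier] subgroup.one_closed[OF subgroup_A]
    by (auto simp: card_gt_0_iff)
  then have "A \<noteq> carrier G" using order_eq by (auto simp: order_def)
  then show ?thesis using A_carrier by blast
qed

lemma A_subset_C: "a \<in> A \<Longrightarrow> A \<subseteq> C a"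
  using A_carrier comm_A by (auto simp: centralizer_def)

text \<open>With a central \<open>z\<close> outside \<open>A\<close>, first every element of
  \<open>A\<close> is central, since it commutes with \<open>A\<close> and with \<open>z\<close>;
  then by the same criterion every element of \<open>G\<close> is.\<close>

lemma center_subset_A: "Z \<subseteq> A"
proof (rule ccontr)
  assume "\<not> Z \<subseteq> A"
  then obtain z where z: "z \<in> Z" "z \<notin> A" by blast
  have zC: "z \<in> C t" if "t \<in> carrier G" for t using z that by (auto simp: centralizer_def)
  have AZ: "A \<subseteq> Z"
  proof
    fix t assume "t \<in> A"
    then show "t \<in> Z" using mem_centerI[of t z] A_subset_C zC z A_carrier by blast
  qed
  have "t \<in> Z" if "t \<in> carrier G" for t
  proof (rule mem_centerI[OF that _ zC[OF that] z(2)])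
    show "A \<subseteq> C t" using AZ that by (auto simp: centralizer_def)
  qed
  then show False using nonabelian centralizer_subset_carrier[of G] by blast
qed

text \<open>If \<open>A\<close> were central, any \<open>x\<close> outside \<open>A\<close> would
  commute with \<open>A\<close> and with itself, hence be central, although the centre lies in
  \<open>A\<close>.\<close>

lemma ex_A_noncentral: "\<exists>a\<in>A. a \<notin> Z"
proof (rule ccontr)
  assume neg: "\<not> ?thesis"
  obtain x where x: "x \<in> carrier G" "x \<notin> A" using ex_not_mem_A by blast
  have "A \<subseteq> C x" using neg x by (auto simp: centralizer_def)
  then have "x \<in> Z" using mem_centerI[of x x] x mem_C_self by blast
  then show False using x center_subset_A by blast
qed

lemma C_mem_A:
  assumes "a \<in> A" "a \<notin> Z"
  shows "C a = A"
  using assms A_subset_C[OF assms(1)] mem_centerI[of a] A_carrier by blast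

lemma A_Int_C:
  assumes "x \<in> carrier G" "x \<notin> A"
  shows "A \<inter> C x = Z"
proof
  show "A \<inter> C x \<subseteq> Z"
    using assms mem_centerI[of _ x] A_subset_C mem_C_sym[OF assms(1)] A_carrier by blast
  show "Z \<subseteq> A \<inter> C x"
    using center_subset_A center_subset_centralizer[of "{x}" G] assms by simp
qed

text \<open>Two elements outside \<open>A\<close> differ by an element of \<open>A\<close>; if both
  lie in \<open>C x\<close>, so does the difference, which is therefore central. Thus
  \<open>C x\<close> is the union of \<open>Z\<close> and one coset of it.\<close>

lemma C_minus_A:
  assumes x: "x \<in> carrier G" "x \<notin> A"
  shows "C x - A = (\<lambda>z. x \<otimes> z) ` Z"
proof
  have S: "subgroup (C x) G" using x by (simp add: subgroup_C)
  have ix: "inv x \<in> carrier G - A"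
    using x subgroup.m_inv_closed[OF subgroup_A, of "inv x"] by auto
  show "C x - A \<subseteq> (\<lambda>z. x \<otimes> z) ` Z"
  proof
    fix y assume y: "y \<in> C x - A"
    then have yc: "y \<in> carrier G" using centralizer_subset_carrier[of G] by blast
    have "inv x \<otimes> y \<in> A" using mult_mem_A[OF ix] y yc by blast
    moreover have "inv x \<otimes> y \<in> C x"
      using y by (intro subgroup.m_closed[OF S] subgroup.m_inv_closed[OF S] mem_C_self x) auto
    ultimately have "inv x \<otimes> y \<in> Z" using A_Int_C[OF x] by blast
    moreover have "y = x \<otimes> (inv x \<otimes> y)" using x yc by (simp flip: m_assoc)
    ultimately show "y \<in> (\<lambda>z. x \<otimes> z) ` Z" by blast
  qed
  show "(\<lambda>z. x \<otimes> z) ` Z \<subseteq> C x - A"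
  proof (rule image_subsetI)
    fix z assume z: "z \<in> Z"
    then have zA: "z \<in> A" and zC: "z \<in> C x" and zc: "z \<in> carrier G"
      using A_Int_C[OF x] A_carrier by auto
    have "x \<otimes> z \<in> C x" by (rule subgroup.m_closed[OF S mem_C_self[OF x(1)] zC])
    moreover have "x \<otimes> z \<notin> A"
    proof
      assume "x \<otimes> z \<in> A"
      then have "x \<otimes> z \<otimes> inv z \<in> A"
        using subgroup.m_closed[OF subgroup_A _ subgroup.m_inv_closed[OF subgroup_A zA]] by blast
      then show False using x zc by (simp add: m_assoc)
    qed
    ultimately show "x \<otimes> z \<in> C x - A" by blast
  qed
qed

text \<open>\<open>C x\<close> is either \<open>A\<close> or generated by \<open>x\<close> over the
  centre. That these centralizers are abelian is the source of the fan structure below.\<close>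

lemma C_abelian:
  assumes x: "x \<in> carrier G" "x \<notin> Z" and y: "y \<in> C x" and w: "w \<in> C x"
  shows "y \<otimes> w = w \<otimes> y"
proof (cases "x \<in> A")
  case True
  then show ?thesis using C_mem_A x y w comm_A by simp
next
  case False
  have c: "y \<in> carrier G" "w \<in> carrier G" using y w centralizer_subset_carrier[of G] by blast+
  consider "y \<in> Z" | "w \<in> Z" | "w \<in> C x - A"
    using A_Int_C[OF x(1) False] w by blast
  then show ?thesis
  proof cases
    case 1
    then show ?thesis using c by (simp add: centralizer_def)
  next
    case 2
    then show ?thesis using c by (simp add: centralizer_def)
  next
    case 3
    then obtain z where z: "z \<in> Z" "w = x \<otimes> z" using C_minus_A[OF x(1) False] by auto
    then have zc: "z \<in> carrier G" and yz: "y \<otimes> z = z \<otimes> y"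
      using c by (auto simp: centralizer_def)
    have xy: "x \<otimes> y = y \<otimes> x" using y by (simp add: centralizer_def)
    have "y \<otimes> (x \<otimes> z) = (x \<otimes> y) \<otimes> z" using x c zc by (simp add: xy m_assoc)
    also have "\<dots> = x \<otimes> z \<otimes> y" using x c zc yz by (simp add: m_assoc)
    finally show ?thesis using z by simp
  qed
qed

text \<open>Since \<open>C x\<close> is abelian, it is contained in \<open>C y\<close>; as
  \<open>x\<close> also lies in \<open>C y\<close>, the reverse inclusion follows by symmetry. Hence
  commuting is an equivalence relation on the noncentral elements.\<close>

lemma C_eq:
  assumes x: "x \<in> carrier G" "x \<notin> Z" and y: "y \<in> C x" "y \<notin> Z"
  shows "C y = C x"
proof -
  have sub: "C u \<subseteq> C v" if "u \<in> carrier G" "u \<notin> Z" "v \<in> C u" for u v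
    using C_abelian[OF that(1,2,3)] by (auto simp: centralizer_def)
  have "y \<in> carrier G" using y centralizer_subset_carrier[of G] by blast
  then show ?thesis using sub[OF x y(1)] sub[of y x] y mem_C_sym[OF x(1) y(1)] by blast
qed

lemma centralizer_C:
  assumes x: "x \<in> carrier G" "x \<notin> Z"
  shows "centralizer G (C x) = C x"
proof
  show "centralizer G (C x) \<subseteq> C x"
    using mem_C_self[OF x(1)] by (auto simp: centralizer_def)
  show "C x \<subseteq> centralizer G (C x)"
    using C_abelian[OF x] centralizer_subset_carrier[of G "{x}"]
    by (auto simp: centralizer_def[of G "C x"])
qed

lemma C_Int_C:
  assumes "x \<in> carrier G" "x \<notin> Z" "y \<in> carrier G" "y \<notin> Z" "C x \<noteq> C y"
  shows "C x \<inter> C y = Z"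
proof
  show "C x \<inter> C y \<subseteq> Z" using C_eq[of x] C_eq[of y] assms by blast
  show "Z \<subseteq> C x \<inter> C y"
    using assms center_subset_centralizer[of "{x}" G] center_subset_centralizer[of "{y}" G] by simp
qed

text \<open>The centralizer of \<open>X\<close> is the intersection of the \<open>C x\<close> with
  \<open>x\<close> in \<open>X\<close>. Central \<open>x\<close> impose no condition, equal
  \<open>C x\<close> collapse to one, and two different ones already cut down to
  \<open>Z\<close>.\<close>

lemma centralizers_eq:
  "centralizers G = insert (carrier G) (insert Z (C ` (carrier G - Z)))"
proof (intro subset_antisym subsetI)
  fix B assume "B \<in> centralizers G"
  then obtain X where X: "X \<subseteq> carrier G" "B = centralizer G X" by (auto simp: centralizers_def)
  have BC: "B \<subseteq> C x" if "x \<in> X" for x using that X by (auto simp: centralizer_def)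
  have ZB: "Z \<subseteq> B" using X center_subset_centralizer by blast
  show "B \<in> insert (carrier G) (insert Z (C ` (carrier G - Z)))"
  proof (cases "X \<subseteq> Z")
    case True
    then have "B = carrier G" using X by (auto simp: centralizer_def)
    then show ?thesis by simp
  next
    case False
    then obtain x where x: "x \<in> X" "x \<notin> Z" by blast
    show ?thesis
    proof (cases "\<exists>y\<in>X - Z. C y \<noteq> C x")
      case True
      then obtain y where y: "y \<in> X" "y \<notin> Z" "C x \<noteq> C y" by auto
      then have "C x \<inter> C y = Z" using x X C_Int_C by blast
      then have "B = Z" using BC[OF x(1)] BC[OF y(1)] ZB by blast
      then show ?thesis by simp
    next
      case False
      have "g \<in> B" if g: "g \<in> C x" for g
      proof -
        have gc: "g \<in> carrier G" using g centralizer_subset_carrier[of G] by blast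
        have "g \<in> C y" if "y \<in> X" for y
        proof (cases "y \<in> Z")
          case True
          then show ?thesis using gc by (simp add: centralizer_def)
        next
          case ynZ: False
          then show ?thesis using False that g by blast
        qed
        then show ?thesis using gc X by (auto simp: centralizer_def)
      qed
      then have "B = C x" using BC x by blast
      then show ?thesis using x X by blast
    qed
  qed
next
  fix B assume "B \<in> insert (carrier G) (insert Z (C ` (carrier G - Z)))"
  moreover have "carrier G \<in> centralizers G"
    using centralizer_in_centralizers[of Z G] centralizer_subset_carrier[of G "carrier G"]
    by (simp add: centralizer_center)
  ultimately show "B \<in> centralizers G"
    by (auto simp: centralizer_in_centralizers)
qed

lemma fan: "fan_of_centralizers G (C ` (carrier G - Z))"
  unfolding fan_of_centralizers_def
proof (intro conjI ballI impI)
  show "carrier G \<notin> C ` (carrier G - Z)"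
  proof
    assume "carrier G \<in> C ` (carrier G - Z)"
    then obtain x where "x \<in> carrier G" "x \<notin> Z" "C x = carrier G" by force
    then show False by (simp add: mem_center_iff)
  qed
  show "Z \<notin> C ` (carrier G - Z)"
  proof
    assume "Z \<in> C ` (carrier G - Z)"
    then obtain x where "x \<in> carrier G" "x \<notin> Z" "C x = Z" by force
    then show False using mem_C_self[of x] by simp
  qed
  show "centralizer G B = B" if "B \<in> C ` (carrier G - Z)" for B
    using that centralizer_C by blast
  show "B \<inter> D = Z" if "B \<in> C ` (carrier G - Z)" "D \<in> C ` (carrier G - Z)" "B \<noteq> D" for B D
    using that C_Int_C by blast
qed (rule centralizers_eq nonabelian)+

lemma atoms_eq: "C ` (carrier G - Z) = insert A (C ` (carrier G - A))"
proof -
  have "carrier G - Z = (A - Z) \<union> (carrier G - A)"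
    using center_subset_A A_carrier by blast
  moreover have "C ` (A - Z) = {A}"
    using ex_A_noncentral C_mem_A by auto
  ultimately show ?thesis by (simp add: image_Un)
qed

text \<open>The \<open>- 1\<close> discounts the atom \<open>A\<close>. Removing \<open>A\<close>
  from each of the others leaves a coset of \<open>Z\<close>, and these cosets partition the
  complement of \<open>A\<close>, which has as many elements as \<open>A\<close>.\<close>

lemma card_atoms:
  "card Z * (card (C ` (carrier G - Z)) - 1) = card A"
proof -
  let ?M = "C ` (carrier G - A)"
  have fin: "finite ?M" using finite_carrier by simp
  have nA: "A \<notin> ?M" using mem_C_self by auto
  have nZ: "x \<notin> Z" if "x \<notin> A" for x using that center_subset_A by blast
  have inj: "inj_on (\<lambda>B. B - A) ?M"
  proof (rule inj_onI)
    fix B D assume B: "B \<in> ?M" and D: "D \<in> ?M" and eq: "B - A = D - A"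
    then obtain x y where x: "x \<in> carrier G" "x \<notin> A" "B = C x" and y: "y \<in> carrier G" "y \<notin> A" "D = C y"
      by auto
    have "x \<in> C y" using eq x y mem_C_self by blast
    then show "B = D" using C_eq[of y x] x y nZ by simp
  qed
  have U: "\<Union> ((\<lambda>B. B - A) ` ?M) = carrier G - A"
  proof
    show "\<Union> ((\<lambda>B. B - A) ` ?M) \<subseteq> carrier G - A"
      by (auto simp: centralizer_def)
    show "carrier G - A \<subseteq> \<Union> ((\<lambda>B. B - A) ` ?M)"
    proof
      fix x assume x: "x \<in> carrier G - A"
      then have "x \<in> C x - A" using mem_C_self by simp
      then show "x \<in> \<Union> ((\<lambda>B. B - A) ` ?M)" using x by (intro UnionI[of "C x - A"] imageI)
    qed
  qed
  have "card Z * card ((\<lambda>B. B - A) ` ?M) = card (\<Union> ((\<lambda>B. B - A) ` ?M))"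
  proof (rule card_partition)
    show "finite (\<Union> ((\<lambda>B. B - A) ` ?M))" using U finite_carrier by simp
    show "card D = card Z" if D: "D \<in> (\<lambda>B. B - A) ` ?M" for D
    proof -
      obtain x where x: "x \<in> carrier G" "x \<notin> A" "D = C x - A" using D by auto
      have "inj_on (\<lambda>z. x \<otimes> z) Z"
        using x by (intro inj_onI) (auto simp: centralizer_def)
      then show ?thesis using x C_minus_A card_image by metis
    qed
    show "D \<inter> E = {}" if DE: "D \<in> (\<lambda>B. B - A) ` ?M" "E \<in> (\<lambda>B. B - A) ` ?M" "D \<noteq> E" for D E
    proof -
      obtain x where x: "x \<in> carrier G" "x \<notin> A" "D = C x - A" using DE(1) by auto
      obtain y where y: "y \<in> carrier G" "y \<notin> A" "E = C y - A" using DE(2) by auto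
      have "C x \<inter> C y = Z" using C_Int_C[of x y] x y nZ DE(3) by blast
      then show ?thesis using x y center_subset_A by blast
    qed
  qed (use fin in auto)
  moreover have "card (carrier G - A) = card A"
    using card_Diff_subset[OF finite_subset[OF A_carrier finite_carrier] A_carrier] order_eq
    by (simp add: order_def)
  ultimately show ?thesis using card_image[OF inj] fin nA U by (simp add: atoms_eq)
qed

end

section \<open>Counting the atoms and comparing two groups\<close>

lemma (in maximal_class_group) ex_fan:
  "\<exists>M. fan_of_centralizers G M \<and> finite M \<and> card M = 2 ^ (n - 2) + 1"
proof -
  obtain A where A: "subgroup A G" "order G = 2 * card A" "\<forall>x\<in>A. \<forall>y\<in>A. x \<otimes> y = y \<otimes> x"
    using ex_abelian_subgroup by blast
  interpret A: abelian_index_2 G A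
    using A finite_carrier not_commutative
    by (intro abelian_index_2.intro abelian_index_2_axioms.intro is_group) auto
  let ?M = "A.C ` (carrier G - A.Z)"
  obtain m where "n = m + 2" using n_gt by (metis le_add_diff_inverse2 less_imp_le)
  then have "(2 :: nat) ^ n = 4 * 2 ^ (n - 2)" by simp
  then have "2 ^ (n - 2) = card ?M - 1"
    using A.card_atoms card_center A(2) order_eq by simp
  \<comment> \<open>Needed to undo the truncated subtraction in \<open>card ?M - 1\<close>.\<close>
  moreover have "card ?M > 0"
    using finite_carrier A.atoms_eq by (auto simp: card_gt_0_iff)
  ultimately have "card ?M = 2 ^ (n - 2) + 1" by linarith
  then show ?thesis using A.fan finite_carrier by blast
qed

theorem corollary1p2:
  fixes G :: "('a, 'b) monoid_scheme" and H :: "('c, 'd) monoid_scheme" and n :: nat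
  assumes "n > 2"
    and "maximal_class_2_group G" and "order G = 2 ^ n"
    and "maximal_class_2_group H" and "order H = 2 ^ n"
  shows "centralizer_lattices_isomorphic G H"
proof -
  obtain M where "fan_of_centralizers G M" "finite M" "card M = 2 ^ (n - 2) + 1"
    using maximal_class_group.ex_fan[OF maximal_class_groupI[OF assms(1,2,3)]] by blast
  moreover obtain N where "fan_of_centralizers H N" "finite N" "card N = 2 ^ (n - 2) + 1"
    using maximal_class_group.ex_fan[OF maximal_class_groupI[OF assms(1,4,5)]] by blast
  \<comment> \<open>The number of atoms depends on \<open>n\<close> alone, so the two fans
    match.\<close>
  ultimately show ?thesis by (intro fan_of_centralizers_isomorphic) auto
qed

end
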